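(* Let $n\ge 0$ be an integer and let $\lambda\in\mathbb{C}$ be nonzero. Then $$\beta_{n,\lambda}^{(2)}=\sum_{l=0}^{n}\binom{n}{l}\beta_{l,\lambda}(1)\,\frac{b_{n-l,\lambda}(-\lambda)}{n-l+1}.$$
   Context: All generating function identities are identities of formal power series in $t$, with $\lambda$ nonzero, $(1+\lambda t)^{a}=\sum_{j\ge0}(a)_j\lambda^j\frac{t^j}{j!}$ and $(a)_j=a(a-1)\cdots(a-j+1)$, $(a)_0=1$. For $k\in\mathbb{Z}$, $\mathrm{Li}_k(u)=\sum_{n=1}^{\infty}\frac{u^n}{n^k}$. The fully degenerate poly-Bernoulli numbers $\beta_{n,\lambda}^{(k)}$ are defined by $$\frac{\mathrm{Li}_{k}\left(1-(1+\lambda t)^{-1/\lambda}\right)}{1-(1+\lambda t)^{-1/\lambda}}=\sum_{n=0}^{\infty}\beta_{n,\lambda}^{(k)}\frac{t^{n}}{n!},$$ where $\mathrm{Li}_k(u)/u$ denotes the series $\sum_{m\ge 0}u^m/(m+1)^k$; here $k=2$. Carlitz's degenerate Bernoulli polynomials $\beta_{n,\lambda}(x)$ (no superscript) are defined by $$\frac{t}{(1+\lambda t)^{1/\lambda}-1}(1+\lambda t)^{x/\lambda}=\sum_{n=0}^{\infty}\beta_{n,\lambda}(x)\frac{t^n}{n!}.$$ The polynomials $b_{n,\lambda}(x)$ are defined by $$\frac{\frac{1}{\lambda}\log(1+\lambda t)}{(1+\lambda t)^{1/\lambda}-1}(1+\lambda t)^{x/\lambda}=\sum_{n=0}^{\infty}b_{n,\lambda}(x)\frac{t^n}{n!},$$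 and $b_{m,\lambda}(-\lambda)$ is the value at $x=-\lambda$. *)

theory Defs
  imports Complex_Main "HOL-Computational_Algebra.Formal_Power_Series"
begin

unbundle fps_syntax

(* The formal series (1 + lam t)^a in t. *)
definition deg_pow :: "complex \<Rightarrow> complex \<Rightarrow> complex fps" where
  "deg_pow lam a = fps_binomial a oo (fps_const lam * fps_X)"

lemma deg_pow_nth:
  "deg_pow lam a $ j = (\<Prod>i<j. a - of_nat i) * lam ^ j / fact j"
  by (simp add: deg_pow_def fps_compose_linear gbinomial_prod_rev atLeast0LessThan)

(* The formal series log (1 + lam t) in t. *)
definition deg_log :: "complex \<Rightarrow> complex fps" where
  "deg_log lam = fps_ln 1 oo (fps_const lam * fps_X)"

definition polylog_fps :: "int \<Rightarrow> complex fps" where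
  "polylog_fps k = Abs_fps (\<lambda>n. if n = 0 then 0 else 1 / of_nat n powi k)"

(* Li_k(u)/u as the series in u whose m-th coefficient is 1 / (m + 1)^k. *)
definition polylog_quot_fps :: "int \<Rightarrow> complex fps" where
  "polylog_quot_fps k = Abs_fps (\<lambda>m. 1 / of_nat (m + 1) powi k)"

lemma polylog_fps_eq: "polylog_fps k = fps_X * polylog_quot_fps k"
  by (rule fps_ext) (simp add: polylog_fps_def polylog_quot_fps_def)

(* Composition is substitution here since the inner series has constant term 0. *)
definition poly_bernoulli_gf :: "int \<Rightarrow> complex \<Rightarrow> complex fps" where
  "poly_bernoulli_gf k lam = polylog_quot_fps k oo (1 - deg_pow lam (- 1 / lam))"

definition poly_bernoulli :: "int \<Rightarrow> nat \<Rightarrow> complex \<Rightarrow> complex" where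
  "poly_bernoulli k n lam = fact n * poly_bernoulli_gf k lam $ n"

(* For lam \<noteq> 0 the denominator below has subdegree 1 and divides the numerator,
   so the division of formal power series is exact; see the lemmas at the end. *)
definition carlitz_bernoulli_gf :: "complex \<Rightarrow> complex \<Rightarrow> complex fps" where
  "carlitz_bernoulli_gf lam x =
     fps_X / (deg_pow lam (1 / lam) - 1) * deg_pow lam (x / lam)"

definition carlitz_bernoulli :: "nat \<Rightarrow> complex \<Rightarrow> complex \<Rightarrow> complex" where
  "carlitz_bernoulli n lam x = fact n * carlitz_bernoulli_gf lam x $ n"

definition log_bernoulli_gf :: "complex \<Rightarrow> complex \<Rightarrow> complex fps" where
  "log_bernoulli_gf lam x =
     (fps_const (1 / lam) * deg_log lam) / (deg_pow lam (1 / lam) - 1) * deg_pow lam (x / lam)"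

definition log_bernoulli :: "nat \<Rightarrow> complex \<Rightarrow> complex \<Rightarrow> complex" where
  "log_bernoulli n lam x = fact n * log_bernoulli_gf lam x $ n"

lemma deg_pow_nth_0 [simp]: "deg_pow lam a $ 0 = 1"
  by (simp add: deg_pow_nth)

lemma deg_pow_nth_1: "deg_pow lam a $ 1 = a * lam"
  by (simp add: deg_pow_nth)

lemma subdegree_deg_pow_minus_1:
  assumes "lam \<noteq> 0" "a \<noteq> 0"
  shows "subdegree (deg_pow lam a - 1) = 1"
  using assms by (intro subdegreeI) (auto simp: deg_pow_nth_1[simplified])

lemma deg_pow_minus_1_dvd:
  assumes "lam \<noteq> 0" "a \<noteq> 0" "f $ 0 = 0"
  shows "deg_pow lam a - 1 dvd f"
proof (cases "f = 0")
  case False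
  have "deg_pow lam a - 1 \<noteq> 0"
    using subdegree_deg_pow_minus_1[OF assms(1,2)] by auto
  moreover have "subdegree f \<ge> 1"
    using False assms(3) by (intro subdegree_geI) auto
  ultimately show ?thesis
    using False subdegree_deg_pow_minus_1[OF assms(1,2)] by (simp add: fps_dvd_iff)
qed simp

lemma carlitz_bernoulli_gf_exact:
  assumes "lam \<noteq> 0"
  shows "carlitz_bernoulli_gf lam x * (deg_pow lam (1 / lam) - 1) =
           fps_X * deg_pow lam (x / lam)"
proof -
  have "deg_pow lam (1 / lam) - 1 dvd fps_X"
    using assms by (intro deg_pow_minus_1_dvd) auto
  then show ?thesis
    unfolding carlitz_bernoulli_gf_def by (metis dvd_div_mult_self mult.assoc mult.commute)
qed

lemma log_bernoulli_gf_exact: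
  assumes "lam \<noteq> 0"
  shows "log_bernoulli_gf lam x * (deg_pow lam (1 / lam) - 1) =
           fps_const (1 / lam) * deg_log lam * deg_pow lam (x / lam)"
proof -
  have "deg_pow lam (1 / lam) - 1 dvd fps_const (1 / lam) * deg_log lam"
    using assms by (intro deg_pow_minus_1_dvd) (auto simp: deg_log_def)
  then show ?thesis
    unfolding log_bernoulli_gf_def by (metis dvd_div_mult_self mult.assoc mult.commute)
qed

lemma poly_bernoulli_gf_exact:
  "poly_bernoulli_gf k lam * (1 - deg_pow lam (- 1 / lam)) =
     polylog_fps k oo (1 - deg_pow lam (- 1 / lam))"
  by (simp add: poly_bernoulli_gf_def polylog_fps_eq fps_compose_mult_distrib mult.commute)

end

theory Submission
  imports Defs
begin

text \<open>Put \<open>u = 1 - (1 + \<lambda>t)^(-1/\<lambda>)\<close>. Since \<open>-log (1 - u) = log (1 + \<lambda>t) / \<lambda>\<close> is \<open>Li\<^sub>1 u\<close>, the derivative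
  of \<open>Li\<^sub>2 u\<close> in \<open>t\<close> is \<open>Li\<^sub>1 u * u' / u\<close>, which is the generating function of \<open>b(-\<lambda>)\<close>. On the other
  hand \<open>t / u\<close> is the generating function of \<open>\<beta>(1)\<close>, so \<open>Li\<^sub>2 u / u = (t / u) * (Li\<^sub>2 u / t)\<close> is the
  product of the latter with the integrated series of the former.\<close>

lemma deg_pow_add: "deg_pow lam (a + b) = deg_pow lam a * deg_pow lam b"
  by (simp add: deg_pow_def fps_binomial_add_mult fps_compose_mult_distrib)

lemma deg_pow_0 [simp]: "deg_pow lam 0 = 1"
  by (simp add: deg_pow_def)

lemma fps_deriv_deg_pow:
  "fps_deriv (deg_pow lam a) = fps_const (a * lam) * deg_pow lam (a - 1)"
proof (rule fps_ext)
  fix n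
  have "(\<Prod>i<Suc n. a - of_nat i) = a * (\<Prod>i<n. (a - 1) - of_nat i)"
    by (subst prod.lessThan_Suc_shift) (simp add: algebra_simps)
  then show "fps_deriv (deg_pow lam a) $ n = (fps_const (a * lam) * deg_pow lam (a - 1)) $ n"
    by (simp add: deg_pow_nth field_simps del: prod.lessThan_Suc of_nat_Suc)
qed

lemma fps_deriv_deg_log: "fps_deriv (deg_log lam) = fps_const lam * deg_pow lam (- 1)"
proof (rule fps_ext)
  fix n
  have "(\<Prod>i<n. - 1 - of_nat i :: complex) = (- 1) ^ n * fact n"
    by (induction n) (simp_all add: algebra_simps)
  then show "fps_deriv (deg_log lam) $ n = (fps_const lam * deg_pow lam (- 1)) $ n"
    by (simp add: deg_log_def deg_pow_nth fps_compose_linear fps_ln_nth del: of_nat_Suc)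
qed

lemma fps_deriv_polylog: "fps_deriv (polylog_fps k) = polylog_quot_fps (k - 1)"
  by (rule fps_ext)
    (simp add: polylog_fps_def polylog_quot_fps_def power_int_diff del: of_nat_Suc)

text \<open>Geometric series: \<open>polylog_quot_fps 0\<close> has all coefficients 1.\<close>

lemma polylog_quot_fps_0: "polylog_quot_fps 0 * (1 - fps_X) = 1"
  by (rule fps_ext) (simp add: polylog_quot_fps_def algebra_simps)

context
  fixes lam :: complex and u :: "complex fps"
  assumes lam: "lam \<noteq> 0"
  defines "u \<equiv> 1 - deg_pow lam (- 1 / lam)"
begin

lemma u_nth_0: "u $ 0 = 0"
  by (simp add: u_def)

lemma deg_pow_inverse: "deg_pow lam (1 / lam) * deg_pow lam (- 1 / lam) = 1"
  by (simp flip: deg_pow_add)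

text \<open>Used to trade the denominator shared by both Bernoulli series for \<open>u\<close> times
  a unit.\<close>

lemma u_mult_deg_pow: "u * deg_pow lam (1 / lam) = deg_pow lam (1 / lam) - 1"
  using deg_pow_inverse by (simp add: u_def algebra_simps)

lemma fps_deriv_u: "fps_deriv u = deg_pow lam (- 1) * deg_pow lam (- 1 / lam)"
  using lam deg_pow_add[of lam "- 1" "- 1 / lam"]
  by (simp add: u_def fps_deriv_deg_pow minus_diff_commute flip: fps_const_neg)

text \<open>Both sides vanish at 0, so comparing derivatives suffices. Since \<open>1 - u\<close> is
  the power with exponent \<open>- 1 / lam\<close>, the factor \<open>1 / (1 - u)\<close> from the
  chain rule cancels that power in the derivative of \<open>u\<close> and leaves
  \<open>1 / (1 + lam t)\<close>.\<close>

lemma polylog_1_compose: "polylog_fps 1 oo u = fps_const (1 / lam) * deg_log lam"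
proof -
  have "(polylog_quot_fps 0 oo u) * deg_pow lam (- 1 / lam) = (polylog_quot_fps 0 * (1 - fps_X)) oo u"
    by (simp add: fps_compose_mult_distrib u_nth_0 fps_compose_sub_distrib) (simp add: u_def)
  then have *: "(polylog_quot_fps 0 oo u) * deg_pow lam (- 1 / lam) = 1"
    by (simp add: polylog_quot_fps_0)
  have "fps_deriv (polylog_fps 1 oo u)
      = deg_pow lam (- 1) * ((polylog_quot_fps 0 oo u) * deg_pow lam (- 1 / lam))"
    by (simp add: fps_compose_deriv u_nth_0 fps_deriv_polylog fps_deriv_u)
  also have "\<dots> = fps_deriv (fps_const (1 / lam) * deg_log lam)"
    using lam by (simp add: * fps_deriv_deg_log flip: mult.assoc del: divide_minus_left)
  finally show ?thesis
    by (subst (asm) fps_deriv_eq_iff) (simp add: polylog_fps_def deg_log_def)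
qed

lemma fps_deriv_polylog_2_compose:
  "fps_deriv (polylog_fps 2 oo u) = log_bernoulli_gf lam (- lam)"
proof -
  let ?E = "deg_pow lam (1 / lam)"
  have "fps_deriv (polylog_fps 2 oo u) * (?E - 1)
      = (u * (polylog_quot_fps 1 oo u)) * deg_pow lam (- 1) * (?E * deg_pow lam (- 1 / lam))"
    by (simp add: fps_compose_deriv u_nth_0 fps_deriv_polylog fps_deriv_u
        flip: u_mult_deg_pow)
  also have "u * (polylog_quot_fps 1 oo u) = polylog_fps 1 oo u"
    by (simp add: polylog_fps_eq fps_compose_mult_distrib u_nth_0)
  \<comment> \<open>The factor \<open>deg_pow lam (- 1)\<close> left over from the derivative of
    \<open>u\<close> is \<open>deg_pow lam (x / lam)\<close> at \<open>x = - lam\<close>; this is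
    where the argument \<open>- lam\<close> comes from.\<close>
  also have "\<dots> * deg_pow lam (- 1) * (?E * deg_pow lam (- 1 / lam))
      = log_bernoulli_gf lam (- lam) * (?E - 1)"
    using lam log_bernoulli_gf_exact[OF lam, of "- lam"]
    by (simp add: polylog_1_compose deg_pow_inverse[simplified])
  finally show ?thesis
    using subdegree_deg_pow_minus_1[OF lam, of "1 / lam"] lam by auto
qed

lemma u_mult_carlitz_bernoulli_gf: "u * carlitz_bernoulli_gf lam 1 = fps_X"
proof -
  let ?E = "deg_pow lam (1 / lam)"
  have "(u * carlitz_bernoulli_gf lam 1) * ?E = carlitz_bernoulli_gf lam 1 * (?E - 1)"
    by (simp flip: u_mult_deg_pow)
  \<comment> \<open>At \<open>x = 1\<close> the extra power in the Carlitz series is exactly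
    \<open>?E\<close>, which is invertible and cancels.\<close>
  also have "\<dots> = fps_X * ?E"
    by (rule carlitz_bernoulli_gf_exact[OF lam])
  finally show ?thesis
    using deg_pow_inverse by auto
qed

lemma poly_bernoulli_gf_2_factor:
  "poly_bernoulli_gf 2 lam
     = carlitz_bernoulli_gf lam 1 * Abs_fps (\<lambda>n. log_bernoulli_gf lam (- lam) $ n / of_nat (n + 1))"
    (is "?P = ?C * ?M")
proof -
  \<comment> \<open>\<open>fps_X * ?M\<close> is the antiderivative with zero constant term: the
    shift by \<open>fps_X\<close> makes differentiation bring down \<open>n + 1\<close>, cancelling
    the denominator in \<open>?M\<close>.\<close>
  have "fps_deriv (fps_X * ?M) = log_bernoulli_gf lam (- lam)"
    by (rule fps_ext) (simp add: fps_deriv_nth del: of_nat_Suc fps_deriv_mult)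
  then have "fps_deriv (polylog_fps 2 oo u) = fps_deriv (fps_X * ?M)"
    by (simp add: fps_deriv_polylog_2_compose)
  then have "polylog_fps 2 oo u = fps_X * ?M"
    by (subst (asm) fps_deriv_eq_iff) (simp add: polylog_fps_def)
  then have "?P * u = fps_X * ?M"
    using poly_bernoulli_gf_exact[of 2 lam] by (simp add: u_def)
  then have "?P * (u * ?C) = fps_X * ?M * ?C"
    by (simp flip: mult.assoc)
  then have "fps_X * ?P = fps_X * (?C * ?M)"
    by (simp add: u_mult_carlitz_bernoulli_gf ac_simps)
  then show ?thesis
    by (simp only: mult_cancel_left fps_X_neq_zero simp_thms)
qed

end

theorem theorem3:
  fixes n :: nat and lam :: complex
  assumes "lam \<noteq> 0"
  shows "poly_bernoulli 2 n lam =
           (\<Sum>l=0..n. of_nat (n choose l) * carlitz_bernoulli l lam 1 *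
             (log_bernoulli (n - l) lam (- lam) / of_nat (n - l + 1)))"
proof -
  have "poly_bernoulli 2 n lam = (\<Sum>l=0..n. fact n * (carlitz_bernoulli_gf lam 1 $ l *
          (log_bernoulli_gf lam (- lam) $ (n - l) / of_nat (n - l + 1))))"
    by (simp add: poly_bernoulli_def poly_bernoulli_gf_2_factor[OF assms] fps_mult_nth
        sum_distrib_left)
  \<comment> \<open>Splitting \<open>fact n\<close> as
    \<open>(n choose l) * fact l * fact (n - l)\<close> turns the Cauchy product into a binomial
    convolution.\<close>
  also have "\<dots> = (\<Sum>l=0..n. of_nat (n choose l) * carlitz_bernoulli l lam 1 *
             (log_bernoulli (n - l) lam (- lam) / of_nat (n - l + 1)))"
    by (intro sum.cong refl)
      (simp add: carlitz_bernoulli_def log_bernoulli_def binomial_fact del: of_nat_Suc)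
  finally show ?thesis .
qed

end
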